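(* Let $g$ be a derivator, $n\in\mathbb N$ and $x_0\in\mathbb R$. Let $\lambda=(\lambda_0,\dots,\lambda_n)\in\mathbb R^{n+1}$ and consider the $g$-polynomial $p=\operatorname{L}_{x_0}(\lambda)=\sum_{k=0}^n\lambda_k g_{x_0,k}$. If $p$ has $n+1$ pairwise $g$-distinct roots in $\mathbb R_+$ (of type I or type II), then $\lambda=0$.
   Context: $\mathbb N=\{0,1,2,\dots\}$. A derivator is a left-continuous nondecreasing function $g:\mathbb R\to\mathbb R$; $\mu_g$ is the Lebesgue–Stieltjes measure with $\mu_g([a,b))=g(b)-g(a)$. Write $g(t^+)$ for the right-hand limit, $\Delta g(t)=g(t^+)-g(t)$, $D_g=\{t\in\mathbb R:\Delta g(t)>0\}$. $\mathbb R_+$ is the disjoint union of $\mathbb R$ and a formal copy $\{t^+:t\in D_g\}$ of $D_g$; $g$ is extended to $\mathbb R_+$ by letting $g(t^+)$ be the right-hand limit of $g$ at $t$. Points $x,y\in\mathbb R_+$ are $g$-distinct if $g(x)\ne g(y)$. Put $\int_x^y f\,d\mu_g=\int_{[x,y)}f\,d\mu_g$ if $y\ge x$ and $-\int_{[y,x)}f\,d\mu_g$ if $y<x$. For $x_0\in\mathbb R$ the $g$-monomials are $g_{x_0,0}(x)=1$ and $g_{x_0,n}(x)=n\int_{x_0}^x g_{x_0,n-1}\,d\mu_g$ for $n\ge1$, $x\in\mathbb R$. Linear combinations of $g$-monomials ($g$-polynomials) are evaluated at $t^+$ ($t\in D_g$) by the right-hand limit at $t$. Roots: a real $g$-polynomial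 $p$ has a root of type I at $t\in\mathbb R_+$ if $p(t)=0$, and a root of type II at $t$ if $t\in D_g$ and $p(t)p(t^+)<0$. *)

theory Defs
  imports "HOL-Analysis.Analysis"
begin

definition derivator :: "(real \<Rightarrow> real) \<Rightarrow> bool" where
  "derivator g \<longleftrightarrow> mono g \<and> (\<forall>x. continuous (at_left x) g)"

definition rlim :: "(real \<Rightarrow> real) \<Rightarrow> real \<Rightarrow> real" where
  "rlim f t = Lim (at_right t) f"

definition jumps :: "(real \<Rightarrow> real) \<Rightarrow> real set" where
  "jumps g = {t. rlim g t - g t > 0}"

text \<open>The library constant \<^const>\<open>interval_measure\<close> takes a right-continuous
  \<open>F\<close> and gives \<open>{a<..b}\<close> the mass \<open>F b - F a\<close>, so the measure of a
  left-continuous \<open>g\<close> is built from its right-limit function; lemma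
  \<open>emeasure_LS_measure\<close> below shows that \<open>{a..<b}\<close> then has mass \<open>g b - g a\<close>.\<close>

definition LS_measure :: "(real \<Rightarrow> real) \<Rightarrow> real measure" where
  "LS_measure g = interval_measure (rlim g)"

lemma rlim_tendsto:
  assumes "mono g" shows "(g \<longlongrightarrow> rlim g t) (at_right t)"
proof -
  have "(g \<longlongrightarrow> Inf (g ` ({t<..} \<inter> UNIV))) (at t within ({t<..} \<inter> UNIV))"
    by (rule Lim_right_bound[where K = "g t"]) (use assms in \<open>auto simp: mono_def\<close>)
  then have "(g \<longlongrightarrow> Inf (g ` {t<..})) (at_right t)" by simp
  then show ?thesis
    unfolding rlim_def by (metis tendsto_Lim trivial_limit_at_right_real)
qed

lemma rlim_bounds:
  assumes "mono g" shows "g t \<le> rlim g t" and "t < u \<Longrightarrow> rlim g t \<le> g u"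
proof -
  show "g t \<le> rlim g t"
    by (rule tendsto_lowerbound[OF rlim_tendsto[OF assms]])
       (use assms in \<open>auto simp: mono_def eventually_at_filter\<close>)
  assume "t < u"
  then have "\<forall>\<^sub>F x in at_right t. g x \<le> g u"
    unfolding eventually_at_right_field by (meson assms less_imp_le monoD)
  then show "rlim g t \<le> g u"
    by (rule tendsto_upperbound[OF rlim_tendsto[OF assms]]) simp
qed

lemma rlim_mono: assumes "mono g" "x \<le> y" shows "rlim g x \<le> rlim g y"
  using rlim_bounds[OF assms(1)] assms(2) by (metis order.order_iff_strict order_trans)

lemma rlim_right_cont: assumes "mono g" shows "continuous (at_right x) (rlim g)"
  unfolding continuous_within
proof (rule order_tendstoI)
  fix a assume "a < rlim g x"
  then show "\<forall>\<^sub>F y in at_right x. a < rlim g y"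
    unfolding eventually_at_right_field
    by (metis assms less_eq_real_def less_le_trans lt_ex gt_ex rlim_mono)
next
  fix a assume "rlim g x < a"
  then have "\<forall>\<^sub>F y in at_right x. g y < a"
    by (rule order_tendstoD(2)[OF rlim_tendsto[OF assms]])
  then obtain b where b: "b > x" "\<And>y. x < y \<Longrightarrow> y < b \<Longrightarrow> g y < a"
    unfolding eventually_at_right_field by auto
  have "rlim g y < a" if "x < y" "y < b" for y
  proof -
    obtain z where "y < z" "z < b" using dense[OF \<open>y < b\<close>] by auto
    then show ?thesis using b(2)[of z] rlim_bounds(2)[OF assms, of y z] that by auto
  qed
  then show "\<forall>\<^sub>F y in at_right x. rlim g y < a"
    unfolding eventually_at_right_field using b(1) by auto
qed

lemma emeasure_LS_measure_Ioc:
  assumes "mono g" "a \<le> b"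
  shows "emeasure (LS_measure g) {a<..b} = ennreal (rlim g b - rlim g a)"
  unfolding LS_measure_def using assms
  by (intro emeasure_interval_measure_Ioc) (auto intro: rlim_mono rlim_right_cont)

lemma emeasure_LS_measure_singleton:
  assumes "derivator g"
  shows "emeasure (LS_measure g) {a} = ennreal (rlim g a - g a)"
proof -
  have m: "mono g" and l: "continuous (at_left a) g"
    using assms by (auto simp: derivator_def)
  define s where "s n = a - inverse (real (Suc n))" for n
  have sa: "s n < a" for n by (simp add: s_def)
  have s: "s \<longlonglongrightarrow> a"
    unfolding s_def using tendsto_diff[OF tendsto_const LIMSEQ_inverse_real_of_nat, of a] by simp
  have dec: "decseq (\<lambda>n. {s n<..a})"
  proof (unfold decseq_def, intro allI impI)
    fix m n :: nat assume "m \<le> n"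
    then have "s m \<le> s n" by (simp add: s_def le_imp_inverse_le)
    then show "{s n<..a} \<subseteq> {s m<..a}" by auto
  qed
  have Int: "(\<Inter>n. {s n<..a}) = {a}"
  proof (intro equalityI subsetI)
    fix x assume x: "x \<in> (\<Inter>n. {s n<..a})"
    then have "a \<le> x" by (intro LIMSEQ_le_const2[OF s]) (auto intro: less_imp_le)
    with x show "x \<in> {a}" by auto
  qed (use sa in auto)
  have gl: "(\<lambda>n. g (s n)) \<longlonglongrightarrow> g a"
    using l s sa unfolding continuous_within
    by (auto intro!: filterlim_compose[where f = s and g = g] simp: filterlim_at less_imp_neq)
  have "(\<lambda>n. rlim g (s n)) \<longlonglongrightarrow> g a"
    by (rule tendsto_sandwich[OF _ _ gl tendsto_const])
       (use rlim_bounds[OF m] sa in auto)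
  then have "(\<lambda>n. ennreal (rlim g a - rlim g (s n))) \<longlonglongrightarrow> ennreal (rlim g a - g a)"
    by (intro tendsto_intros)
  moreover have "(\<lambda>n. emeasure (LS_measure g) {s n<..a}) \<longlonglongrightarrow> emeasure (LS_measure g) (\<Inter>n. {s n<..a})"
  proof (intro Lim_emeasure_decseq dec)
    show "range (\<lambda>n. {s n<..a}) \<subseteq> sets (LS_measure g)" by (auto simp: LS_measure_def)
    show "emeasure (LS_measure g) {s n<..a} \<noteq> \<infinity>" for n
      using emeasure_LS_measure_Ioc[OF m less_imp_le[OF sa]] by simp
  qed
  ultimately show ?thesis
    unfolding Int using emeasure_LS_measure_Ioc[OF m less_imp_le[OF sa]]
    by (simp add: LIMSEQ_unique)
qed

lemma emeasure_LS_measure: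
  assumes "derivator g" "a \<le> b"
  shows "emeasure (LS_measure g) {a..<b} = ennreal (g b - g a)"
proof -
  have m: "mono g" using assms by (auto simp: derivator_def)
  let ?M = "LS_measure g"
  have "emeasure ?M {a..<b} + emeasure ?M {b} = emeasure ?M ({a..<b} \<union> {b})"
    by (rule plus_emeasure) (auto simp: LS_measure_def)
  also have "{a..<b} \<union> {b} = {a} \<union> {a<..b}" using assms(2) by auto
  also have "emeasure ?M \<dots> = emeasure ?M {a} + emeasure ?M {a<..b}"
    by (rule plus_emeasure[symmetric]) (auto simp: LS_measure_def)
  also have "\<dots> = ennreal (rlim g a - g a) + ennreal (rlim g b - rlim g a)"
    by (simp add: emeasure_LS_measure_singleton emeasure_LS_measure_Ioc assms m)
  also have "\<dots> = ennreal (g b - g a) + ennreal (rlim g b - g b)"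
    using rlim_bounds(1)[OF m] rlim_mono[OF m assms(2)] monoD[OF m assms(2)]
    by (simp flip: ennreal_plus)
  finally show ?thesis
    by (simp add: emeasure_LS_measure_singleton assms add.commute[of _ "ennreal (rlim g b - g b)"])
qed

definition gintegral :: "(real \<Rightarrow> real) \<Rightarrow> real \<Rightarrow> real \<Rightarrow> (real \<Rightarrow> real) \<Rightarrow> real" where
  "gintegral g x y f =
     (if x \<le> y then set_lebesgue_integral (LS_measure g) {x..<y} f
      else - set_lebesgue_integral (LS_measure g) {y..<x} f)"

primrec gmonomial :: "(real \<Rightarrow> real) \<Rightarrow> real \<Rightarrow> nat \<Rightarrow> real \<Rightarrow> real" where
  "gmonomial g x0 0 = (\<lambda>x. 1)"
| "gmonomial g x0 (Suc n) = (\<lambda>x. real (Suc n) * gintegral g x0 x (gmonomial g x0 n))"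

text \<open>A coefficient vector indexed by \<open>0, \<dots>, n\<close> is a function on \<open>nat\<close> of which only
  the values at \<open>k \<le> n\<close> are used.\<close>

definition gpolynomial :: "(real \<Rightarrow> real) \<Rightarrow> real \<Rightarrow> nat \<Rightarrow> (nat \<Rightarrow> real) \<Rightarrow> real \<Rightarrow> real" where
  "gpolynomial g x0 n lam x = (\<Sum>k\<le>n. lam k * gmonomial g x0 k x)"

text \<open>\<open>RightPt t\<close> is the formal point \<open>t\<^sup>+\<close>; it belongs to the extended line of \<open>g\<close>
  only when \<open>t\<close> is a jump of \<open>g\<close>.\<close>

datatype ext_point = Pt real | RightPt real

definition ext_line :: "(real \<Rightarrow> real) \<Rightarrow> ext_point set" where
  "ext_line g = range Pt \<union> RightPt ` jumps g"

primrec ext_eval :: "(real \<Rightarrow> real) \<Rightarrow> ext_point \<Rightarrow> real" where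
  "ext_eval f (Pt t) = f t"
| "ext_eval f (RightPt t) = rlim f t"

definition g_distinct :: "(real \<Rightarrow> real) \<Rightarrow> ext_point \<Rightarrow> ext_point \<Rightarrow> bool" where
  "g_distinct g x y \<longleftrightarrow> ext_eval g x \<noteq> ext_eval g y"

definition root_I :: "(real \<Rightarrow> real) \<Rightarrow> (real \<Rightarrow> real) \<Rightarrow> ext_point \<Rightarrow> bool" where
  "root_I g p x \<longleftrightarrow> x \<in> ext_line g \<and> ext_eval p x = 0"

definition root_II :: "(real \<Rightarrow> real) \<Rightarrow> (real \<Rightarrow> real) \<Rightarrow> ext_point \<Rightarrow> bool" where
  "root_II g p x \<longleftrightarrow>
     (\<exists>t\<in>jumps g. x = Pt t \<and> ext_eval p (Pt t) * ext_eval p (RightPt t) < 0)"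

end

theory Submission
  imports Defs
begin

text \<open>A Rolle argument. The formal derivative \<open>q\<close> of a \<open>g\<close>-polynomial \<open>p\<close> satisfies
  \<open>p y - p x = \<integral>q d\<mu>\<close> over \<open>[x,y)\<close>, so \<open>p\<close> factors through \<open>g\<close>, is left-continuous, and jumps
  by \<open>q(t) \<Delta>g(t)\<close>. Hence a sign change of \<open>q\<close> forces a root of type I or II, and between roots
  of \<open>p\<close> with \<open>g\<close>-values \<open>v < w\<close> there is a root of \<open>q\<close> with \<open>g\<close>-value in \<open>[v,w)\<close>. The half-open
  interval keeps the roots obtained from consecutive gaps \<open>g\<close>-distinct, and induction on the
  degree leaves only constants.\<close>

section \<open>Antiderivatives with respect to the Stieltjes measure\<close>

definition locally_g_integrable :: "(real \<Rightarrow> real) \<Rightarrow> (real \<Rightarrow> real) \<Rightarrow> bool" where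
  "locally_g_integrable g f \<longleftrightarrow> (\<forall>a b. set_integrable (LS_measure g) {a..<b} f)"

text \<open>Integrability is demanded because a non-integrable function has integral 0 by
  convention, so the increment equation alone could hold for the wrong reason.\<close>

definition g_antiderivative :: "(real \<Rightarrow> real) \<Rightarrow> (real \<Rightarrow> real) \<Rightarrow> (real \<Rightarrow> real) \<Rightarrow> bool" where
  "g_antiderivative g F f \<longleftrightarrow> locally_g_integrable g f \<and>
     (\<forall>x y. x \<le> y \<longrightarrow> F y - F x = set_lebesgue_integral (LS_measure g) {x..<y} f)"

text \<open>Roots are recorded by their \<open>g\<close>-values: \<open>g\<close>-distinct roots
  become distinct reals, which can be ordered and counted.\<close>

definition root_values :: "(real \<Rightarrow> real) \<Rightarrow> (real \<Rightarrow> real) \<Rightarrow> real set" where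
  "root_values g p = ext_eval g ` {x. root_I g p x \<or> root_II g p x}"

lemma sets_LS_measure [simp, measurable_cong]: "sets (LS_measure g) = sets borel"
  by (simp add: LS_measure_def)

lemma space_LS_measure [simp]: "space (LS_measure g) = UNIV"
  by (simp add: LS_measure_def)

lemma set_integral_null:
  fixes f :: "real \<Rightarrow> real"
  assumes "J \<in> null_sets M"
  shows "set_lebesgue_integral M J f = 0"
proof -
  have "AE x in M. indicat_real J x *\<^sub>R f x = 0"
    using AE_not_in[OF assms] by eventually_elim simp
  then show ?thesis
    unfolding set_lebesgue_integral_def by (rule integral_eq_zero_AE)
qed

lemma locally_g_integrable_add:
  "locally_g_integrable g F \<Longrightarrow> locally_g_integrable g G \<Longrightarrow> locally_g_integrable g (\<lambda>x. F x + G x)"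
  by (simp add: locally_g_integrable_def)

lemma locally_g_integrable_diff:
  "locally_g_integrable g F \<Longrightarrow> locally_g_integrable g G \<Longrightarrow> locally_g_integrable g (\<lambda>x. F x - G x)"
  by (simp add: locally_g_integrable_def)

lemma g_antiderivative_add:
  assumes "g_antiderivative g F f" "g_antiderivative g G h"
  shows "g_antiderivative g (\<lambda>x. F x + G x) (\<lambda>x. f x + h x)"
  unfolding g_antiderivative_def
proof (intro conjI allI impI)
  show "locally_g_integrable g (\<lambda>x. f x + h x)"
    using assms by (intro locally_g_integrable_add) (simp_all add: g_antiderivative_def)
  fix x y :: real assume "x \<le> y"
  have "set_integrable (LS_measure g) {x..<y} f" "set_integrable (LS_measure g) {x..<y} h"
    using assms by (simp_all add: g_antiderivative_def locally_g_integrable_def)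
  note set_integral_add(2)[OF this]
  moreover have "F y - F x = set_lebesgue_integral (LS_measure g) {x..<y} f"
      "G y - G x = set_lebesgue_integral (LS_measure g) {x..<y} h"
    using assms \<open>x \<le> y\<close> by (simp_all add: g_antiderivative_def)
  ultimately show "F y + G y - (F x + G x) =
      set_lebesgue_integral (LS_measure g) {x..<y} (\<lambda>x. f x + h x)"
    by linarith
qed

lemma g_antiderivative_cmult:
  assumes "g_antiderivative g F f"
  shows "g_antiderivative g (\<lambda>x. c * F x) (\<lambda>x. c * f x)"
  using assms unfolding g_antiderivative_def locally_g_integrable_def
  by (simp flip: right_diff_distrib)

lemma g_antiderivative_uminus:
  "g_antiderivative g F f \<Longrightarrow> g_antiderivative g (\<lambda>x. - F x) (\<lambda>x. - f x)"
  using g_antiderivative_cmult[of g F f "-1"] by simp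

lemma g_antiderivative_const: "g_antiderivative g (\<lambda>x. c) (\<lambda>x. 0)"
  by (simp add: g_antiderivative_def locally_g_integrable_def set_integrable_def set_lebesgue_integral_def)

lemma g_antiderivative_sum:
  assumes "finite A" "\<And>k. k \<in> A \<Longrightarrow> g_antiderivative g (F k) (f k)"
  shows "g_antiderivative g (\<lambda>x. \<Sum>k\<in>A. F k x) (\<lambda>x. \<Sum>k\<in>A. f k x)"
  using assms by induction (simp_all add: g_antiderivative_const g_antiderivative_add)

text \<open>Integrals over adjacent half-open intervals add up; the oriented integral then needs one
  case for each position of \<open>x0\<close> relative to \<open>x\<close> and
  \<open>y\<close>.\<close>

lemma g_antiderivative_gintegral:
  assumes "locally_g_integrable g f"
  shows "g_antiderivative g (\<lambda>x. gintegral g x0 x f) f"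
  unfolding g_antiderivative_def
proof (intro conjI allI impI assms)
  let ?I = "\<lambda>x y. set_lebesgue_integral (LS_measure g) {x..<y} f"
  have split: "?I x z = ?I x y + ?I y z" if "x \<le> y" "y \<le> z" for x y z
  proof -
    have "{x..<z} = {x..<y} \<union> {y..<z}" using that by auto
    moreover have "{x..<y} \<inter> {y..<z} = {}" by auto
    moreover have "set_integrable (LS_measure g) {u..<v} f" for u v
      using assms by (simp add: locally_g_integrable_def)
    ultimately show ?thesis by (simp only: set_integral_Un)
  qed
  fix x y :: real assume "x \<le> y"
  have oriented: "gintegral g x0 z f = (if x0 \<le> z then ?I x0 z else - ?I z x0)" for z
    by (simp add: gintegral_def)
  consider "x0 \<le> x" | "x < x0" "x0 \<le> y" | "y < x0" by linarith
  then show "gintegral g x0 y f - gintegral g x0 x f = ?I x y"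
  proof cases
    case 1 then show ?thesis
      using split[of x0 x y] \<open>x \<le> y\<close> by (simp add: oriented)
  next
    case 2 then show ?thesis using split[of x x0 y] by (simp add: oriented)
  next
    case 3 then show ?thesis using split[of x y x0] \<open>x \<le> y\<close> by (simp add: oriented)
  qed
qed

section \<open>Counting values that separate a finite set\<close>

lemma separated_values_card:
  fixes V W :: "real set"
  assumes "finite V" "card V = Suc m"
    and sep: "\<And>a b. a \<in> V \<Longrightarrow> b \<in> V \<Longrightarrow> a < b \<Longrightarrow> \<exists>c\<in>W. a \<le> c \<and> c < b"
  obtains V' where "V' \<subseteq> W" "finite V'" "card V' = m"
proof -
  have ne: "V \<noteq> {}" using assms by auto
  \<comment> \<open>The successor of \<open>a\<close> in \<open>V\<close>. It is meaningless at
    \<open>Max V\<close>, which is therefore removed and accounts for the loss of one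
    element.\<close>
  define nxt where "nxt a = Min {b \<in> V. a < b}" for a
  let ?V = "V - {Max V}"
  have nxt: "nxt a \<in> V \<and> a < nxt a" if "a \<in> ?V" for a
  proof -
    have "a < Max V" using that assms(1) by (simp add: order.not_eq_order_implies_strict)
    then have "{b \<in> V. a < b} \<noteq> {}" using Max_in[OF assms(1) ne] by blast
    then have "nxt a \<in> {b \<in> V. a < b}" unfolding nxt_def using assms(1) by (intro Min_in) auto
    then show ?thesis by simp
  qed
  have "\<forall>a\<in>?V. \<exists>c\<in>W. a \<le> c \<and> c < nxt a"
    using nxt sep by blast
  then obtain f where f: "\<And>a. a \<in> ?V \<Longrightarrow> f a \<in> W \<and> a \<le> f a \<and> f a < nxt a"
    by metis
  \<comment> \<open>The gaps \<open>{a..<nxt a}\<close> are disjoint: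
    \<open>f a < nxt a \<le> a' \<le> f a'\<close>.\<close>
  have less: "f a < f a'" if "a \<in> ?V" "a' \<in> ?V" "a < a'" for a a'
  proof -
    have "nxt a \<le> a'" unfolding nxt_def using that assms(1) by (intro Min_le) auto
    then show ?thesis using f[OF that(1)] f[OF that(2)] by linarith
  qed
  have "inj_on f ?V"
    by (rule inj_onI) (metis less less_irrefl linorder_neqE_linordered_idom)
  then have "card (f ` ?V) = card ?V" by (rule card_image)
  also have "\<dots> = m" using assms Max_in[OF assms(1) ne] by simp
  finally show ?thesis using that[of "f ` ?V"] f assms(1) by blast
qed

section \<open>Integrability of monotone functions and of antiderivatives\<close>

context
  fixes g :: "real \<Rightarrow> real"
  assumes derivator: "derivator g"
begin

lemma mono_g: "mono g"
  using derivator by (simp add: derivator_def)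

lemma g_le: "x \<le> y \<Longrightarrow> g x \<le> g y"
  using mono_g by (rule monoD)

lemma g_less_imp_less: "g x < g y \<Longrightarrow> x < y"
  using g_le not_le by metis

text \<open>A monotone function is Borel and is bounded on \<open>{a..<b}\<close> by means of its
  endpoint values, and the interval has finite mass.\<close>

lemma mono_locally_g_integrable:
  assumes "mono F" shows "locally_g_integrable g F"
  unfolding locally_g_integrable_def set_integrable_def
proof (intro allI)
  fix a b :: real
  show "integrable (LS_measure g) (\<lambda>x. indicat_real {a..<b} x *\<^sub>R F x)"
  proof (rule integrableI_bounded_set_indicator[where B = "\<bar>F a\<bar> + \<bar>F b\<bar>"])
    show "{a..<b} \<in> sets (LS_measure g)" by simp
    have "F \<in> borel_measurable borel" using assms by (rule borel_measurable_mono)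
    then show "F \<in> borel_measurable (LS_measure g)" by (simp add: measurable_def)
    show "emeasure (LS_measure g) {a..<b} < \<infinity>"
      using emeasure_LS_measure[OF derivator, of a b] by (cases "a \<le> b") simp_all
    show "AE x in LS_measure g. x \<in> {a..<b} \<longrightarrow> norm (F x) \<le> \<bar>F a\<bar> + \<bar>F b\<bar>"
    proof (intro AE_I2 impI)
      fix x assume "x \<in> {a..<b}"
      then have "F a \<le> F x" "F x \<le> F b" using monoD[OF assms] by simp_all
      then show "norm (F x) \<le> \<bar>F a\<bar> + \<bar>F b\<bar>" by simp
    qed
  qed
qed

lemma mono_if_g_antiderivative_nonneg:
  assumes "g_antiderivative g F f" "\<And>x. f x \<ge> 0"
  shows "mono F"
proof (rule monoI)
  fix x y :: real assume "x \<le> y"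
  moreover have "set_lebesgue_integral (LS_measure g) {x..<y} f \<ge> 0"
    using assms(2) by (simp add: set_lebesgue_integral_def)
  ultimately show "F x \<le> F y"
    using assms(1) unfolding g_antiderivative_def by fastforce
qed

text \<open>An antiderivative is a difference of two monotone functions, which also settles
  measurability.\<close>

lemma g_antiderivative_locally_g_integrable:
  assumes "g_antiderivative g F f"
  shows "locally_g_integrable g F"
proof -
  have f: "locally_g_integrable g f" using assms by (simp add: g_antiderivative_def)
  let ?P = "\<lambda>x. max (f x) 0" and ?N = "\<lambda>x. max (- f x) 0"
  have P: "locally_g_integrable g ?P" and N: "locally_g_integrable g ?N"
    unfolding locally_g_integrable_def set_integrable_def
  proof (safe)
    fix a b :: real
    have i: "integrable (LS_measure g) (\<lambda>x. indicat_real {a..<b} x *\<^sub>R f x)"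
      using f by (auto simp: locally_g_integrable_def set_integrable_def)
    have e: "(\<lambda>x. indicat_real {a..<b} x *\<^sub>R ?P x) = (\<lambda>x. max (indicat_real {a..<b} x *\<^sub>R f x) 0)"
            "(\<lambda>x. indicat_real {a..<b} x *\<^sub>R ?N x) = (\<lambda>x. max (- (indicat_real {a..<b} x *\<^sub>R f x)) 0)"
      by (auto simp: indicator_def)
    show "integrable (LS_measure g) (\<lambda>x. indicat_real {a..<b} x *\<^sub>R ?P x)"
      "integrable (LS_measure g) (\<lambda>x. indicat_real {a..<b} x *\<^sub>R ?N x)"
      unfolding e by (intro integrable_max integrable_minus i integrable_zero)+
  qed
  let ?G = "\<lambda>x. gintegral g 0 x ?P" and ?H = "\<lambda>x. gintegral g 0 x ?N"
  have G: "g_antiderivative g ?G ?P" and H: "g_antiderivative g ?H ?N"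
    using P N by (auto intro: g_antiderivative_gintegral)
  have "g_antiderivative g (\<lambda>x. ?G x + - ?H x) (\<lambda>x. ?P x + - ?N x)"
    by (intro g_antiderivative_add G g_antiderivative_uminus H)
  also have "(\<lambda>x. ?P x + - ?N x) = f" by auto
  finally have GH: "g_antiderivative g (\<lambda>x. ?G x + - ?H x) f" .
  have diff: "F y - F x = (?G y - ?H y) - (?G x - ?H x)" if "x \<le> y" for x y
  proof -
    have "F y - F x = (?G y + - ?H y) - (?G x + - ?H x)"
      using assms GH that unfolding g_antiderivative_def by metis
    then show ?thesis by simp
  qed
  \<comment> \<open>The increment formula is for ordered endpoints only; the two instances cover
    both signs of \<open>x\<close>.\<close>
  have eq: "F x = F 0 + (?G x - ?H x) - (?G 0 - ?H 0)" for x
    using diff[of 0 x] diff[of x 0] by linarith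
  have "locally_g_integrable g ?G" "locally_g_integrable g ?H"
    by (intro mono_locally_g_integrable mono_if_g_antiderivative_nonneg[OF G]
        mono_if_g_antiderivative_nonneg[OF H] max.cobounded2)+
  moreover define d where "d = F 0 - (?G 0 - ?H 0)"
  moreover have "locally_g_integrable g (\<lambda>x. d)"
    by (auto intro!: mono_locally_g_integrable monoI)
  ultimately have "locally_g_integrable g (\<lambda>x. d + (?G x - ?H x))"
    by (intro locally_g_integrable_add locally_g_integrable_diff)
  moreover have "(\<lambda>x. d + (?G x - ?H x)) = F"
  proof
    fix x show "d + (?G x - ?H x) = F x" using eq[of x] unfolding d_def by linarith
  qed
  ultimately show ?thesis by (simp only:)
qed

section \<open>One-sided limits of antiderivatives\<close>

lemma integral_singleton:
  "set_lebesgue_integral (LS_measure g) {t} f = f t * (rlim g t - g t)"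
proof -
  have m: "measure (LS_measure g) {t} = rlim g t - g t"
    using emeasure_LS_measure_singleton[OF derivator, of t] rlim_bounds(1)[OF mono_g, of t]
    by (simp add: measure_def)
  have "set_lebesgue_integral (LS_measure g) {t} f
      = set_lebesgue_integral (LS_measure g) {t} (\<lambda>_. f t)"
    by (intro set_lebesgue_integral_cong) auto
  also have "\<dots> = measure (LS_measure g) {t} *\<^sub>R f t"
    using emeasure_LS_measure_singleton[OF derivator, of t] by (intro set_integral_const) auto
  finally show ?thesis by (simp only: m real_scaleR_def mult.commute)
qed

text \<open>As \<open>S n\<close> decreases to \<open>t\<close>, the intervals
  \<open>{t..<S n}\<close> shrink to the atom \<open>{t}\<close>, whose integral is the jump of
  \<open>F\<close>.\<close>

lemma g_antiderivative_at_right: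
  assumes "g_antiderivative g F f"
  shows "(F \<longlongrightarrow> F t + f t * (rlim g t - g t)) (at_right t)"
proof (rule tendsto_at_right_sequentially[of t "t + 1"])
  fix S :: "nat \<Rightarrow> real"
  assume S: "\<And>n. t < S n" "\<And>n. S n < t + 1" "decseq S" "S \<longlonglongrightarrow> t"
  let ?M = "LS_measure g"
  have "(\<lambda>n. set_lebesgue_integral ?M {t..<S n} f) \<longlonglongrightarrow> set_lebesgue_integral ?M (\<Inter>n. {t..<S n}) f"
  proof (rule set_integral_cont_down)
    show "decseq (\<lambda>n. {t..<S n})"
      using S(3) unfolding decseq_def by fastforce
    show "set_integrable ?M {t..<S 0} f"
      using assms unfolding g_antiderivative_def locally_g_integrable_def by auto
  qed auto
  moreover have "(\<Inter>n. {t..<S n}) = {t}"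
  proof -
    have "x = t" if "\<And>n. t \<le> x \<and> x < S n" for x
      using that LIMSEQ_le_const[OF S(4), of x] by (meson dual_order.eq_iff less_imp_le)
    then show ?thesis using S(1) by force
  qed
  moreover have "set_lebesgue_integral ?M {t..<S n} f = F (S n) - F t" for n
    using assms S(1)[of n] unfolding g_antiderivative_def by auto
  ultimately have "(\<lambda>n. F (S n) - F t) \<longlonglongrightarrow> f t * (rlim g t - g t)"
    by (simp add: integral_singleton)
  from tendsto_add[OF this tendsto_const[of "F t"]]
  show "(\<lambda>n. F (S n)) \<longlonglongrightarrow> F t + f t * (rlim g t - g t)" by (simp add: add.commute)
qed simp

lemma g_antiderivative_rlim:
  assumes "g_antiderivative g F f"
  shows "rlim F t = F t + f t * (rlim g t - g t)"
  unfolding rlim_def[of F] using g_antiderivative_at_right[OF assms]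
  by (intro tendsto_Lim) auto

text \<open>The intervals \<open>{S n..<t}\<close> omit \<open>t\<close> and shrink to the empty
  set, so no jump remains on the left.\<close>

lemma g_antiderivative_at_left:
  assumes "g_antiderivative g F f"
  shows "(F \<longlongrightarrow> F t) (at_left t)"
proof (rule tendsto_at_left_sequentially[of "t - 1"])
  fix S :: "nat \<Rightarrow> real"
  assume S: "\<And>n. S n < t" "\<And>n. t - 1 < S n" "incseq S" "S \<longlonglongrightarrow> t"
  let ?M = "LS_measure g"
  have "(\<lambda>n. set_lebesgue_integral ?M {S n..<t} f) \<longlonglongrightarrow> set_lebesgue_integral ?M (\<Inter>n. {S n..<t}) f"
  proof (rule set_integral_cont_down)
    show "decseq (\<lambda>n. {S n..<t})"
      using S(3) unfolding decseq_def incseq_def by fastforce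
    show "set_integrable ?M {S 0..<t} f"
      using assms unfolding g_antiderivative_def locally_g_integrable_def by auto
  qed auto
  moreover have "(\<Inter>n. {S n..<t}) = {}"
  proof -
    have False if "\<And>n. S n \<le> x \<and> x < t" for x
      using that LIMSEQ_le_const2[OF S(4), of x] by (meson not_le)
    then show ?thesis by fastforce
  qed
  moreover have "set_lebesgue_integral ?M {S n..<t} f = F t - F (S n)" for n
    using assms S(1)[of n] unfolding g_antiderivative_def by auto
  ultimately have "(\<lambda>n. F t - F (S n)) \<longlonglongrightarrow> 0"
    by (simp add: set_lebesgue_integral_def)
  from tendsto_diff[OF tendsto_const[of "F t"] this]
  show "(\<lambda>n. F (S n)) \<longlonglongrightarrow> F t" by simp
qed simp

text \<open>Allows sign arguments to be done for one sign only. The density formula gives the right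
  limits of both functions explicitly, so \<open>rlim\<close> commutes with negation here.\<close>

lemma root_values_uminus:
  assumes "g_antiderivative g F f"
  shows "root_values g (\<lambda>x. - F x) = root_values g F"
proof -
  have "rlim (\<lambda>x. - F x) t = - rlim F t" for t
    using g_antiderivative_rlim[OF assms] g_antiderivative_rlim[OF g_antiderivative_uminus[OF assms]]
    by simp
  then have "ext_eval (\<lambda>x. - F x) x = - ext_eval F x" for x
    by (cases x) auto
  then show ?thesis
    unfolding root_values_def root_I_def root_II_def by simp
qed

section \<open>Values and increments on the extended line\<close>

lemma AE_g_less: "AE r in LS_measure g. r < y \<longrightarrow> g r < g y"
proof -
  let ?M = "LS_measure g"
  \<comment> \<open>The part left of \<open>y\<close> of the plateau at height \<open>g y\<close>.
    Each \<open>{r..<y}\<close> with \<open>r\<close> in \<open>N\<close> is null, and countably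
    many of them have to cover \<open>N\<close>.\<close>
  define N where "N = {r. r < y \<and> g r = g y}"
  have null: "{r..<y} \<in> null_sets ?M" if "r \<in> N" for r
    using that emeasure_LS_measure[OF derivator, of r y] by (auto simp: N_def null_sets_def)
  have "\<exists>A\<in>null_sets ?M. N \<subseteq> A"
  proof (cases "\<exists>m\<in>N. \<forall>s\<in>N. m \<le> s")
    case True
    then obtain m where "m \<in> N" "\<forall>s\<in>N. m \<le> s" by blast
    then have "N \<subseteq> {m..<y}" by (auto simp: N_def)
    then show ?thesis using null[OF \<open>m \<in> N\<close>] by blast
  next
    case False
    \<comment> \<open>If \<open>N\<close> has no least element, the intervals starting at its
      rational points suffice, since a rational between two points of \<open>N\<close> lies in
      \<open>N\<close>.\<close>
    have "s \<in> (\<Union>r\<in>N \<inter> \<rat>. {r..<y})" if s: "s \<in> N" for s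
    proof -
      obtain m where m: "m \<in> N" "m < s" using False s by force
      then obtain q where q: "q \<in> \<rat>" "m < q" "q < s" using Rats_dense_in_real by blast
      have "q \<in> N" using m s q g_le[of m q] g_le[of q s] by (auto simp: N_def)
      then show ?thesis using q s by (intro UN_I[of q]) (auto simp: N_def)
    qed
    moreover have "(\<Union>r\<in>N \<inter> \<rat>. {r..<y}) \<in> null_sets ?M"
      by (intro null_sets_UN' countable_Int2 countable_rat) (use null in auto)
    ultimately show ?thesis by blast
  qed
  then obtain A where A: "A \<in> null_sets ?M" "N \<subseteq> A" by blast
  have "{r \<in> space ?M. \<not> (r < y \<longrightarrow> g r < g y)} \<subseteq> A"
  proof
    fix r assume "r \<in> {r \<in> space ?M. \<not> (r < y \<longrightarrow> g r < g y)}"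
    then have "r < y" "\<not> g r < g y" by simp_all
    then have "r \<in> N" using g_le[of r y] by (simp add: N_def)
    then show "r \<in> A" using A(2) by blast
  qed
  then show ?thesis by (rule AE_I'[OF A(1)])
qed

text \<open>Reduces increments from an extended point to integrals, with position and mass of the
  domain expressed through \<open>g\<close>-values; both the factorisation through \<open>g\<close>
  and strict growth rest on this.\<close>

lemma g_antiderivative_ext_integral:
  assumes F: "g_antiderivative g F f" and a: "a \<in> ext_line g" and le: "ext_eval g a \<le> g y"
  obtains J where "J \<in> sets borel" "J \<subseteq> {r. ext_eval g a \<le> g r \<and> r < y}"
    "emeasure (LS_measure g) J = ennreal (g y - ext_eval g a)"
    "set_integrable (LS_measure g) J f"
    "F y - ext_eval F a = set_lebesgue_integral (LS_measure g) J f"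
proof -
  let ?M = "LS_measure g"
  have int: "set_integrable ?M {x..<z} f" for x z
    using F by (auto simp: g_antiderivative_def locally_g_integrable_def)
  have diff: "F z - F x = set_lebesgue_integral ?M {x..<z} f" if "x \<le> z" for x z
    using F that by (auto simp: g_antiderivative_def)
  show ?thesis
  proof (cases a)
    case (Pt x)
    show ?thesis
    proof (cases "x \<le> y")
      case True
      show ?thesis
        by (rule that[of "{x..<y}"])
          (use Pt True int diff emeasure_LS_measure[OF derivator True] in \<open>auto intro: g_le\<close>)
    next
      \<comment> \<open>A real \<open>a\<close> may lie to the right of \<open>y\<close> on the same
        plateau; then \<open>{y..<x}\<close> is null and the empty set serves as
        \<open>J\<close>.\<close>
      case False
      then have "g x = g y" using le g_le[of y x] Pt by simp
      moreover have "F x - F y = 0"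
      proof -
        have "{y..<x} \<in> null_sets ?M"
          using False emeasure_LS_measure[OF derivator, of y x] \<open>g x = g y\<close> by (auto simp: null_sets_def)
        then show ?thesis
          using diff[of y x] False by (simp add: set_integral_null)
      qed
      ultimately show ?thesis
        by (intro that[of "{}"]) (use Pt in \<open>auto simp: set_integrable_def set_lebesgue_integral_def\<close>)
    qed
  next
    case (RightPt t)
    then have "t \<in> jumps g" using a by (auto simp: ext_line_def)
    then have "t < y" using le RightPt g_le[of y t] by (force simp: jumps_def)
    \<comment> \<open>Dropping the atom \<open>{t}\<close> removes the jump at \<open>t\<close> both
      from the increment of \<open>F\<close> and from the measure.\<close>
    have un: "{t..<y} = {t} \<union> {t<..<y}" using \<open>t < y\<close> by auto
    have int': "set_integrable ?M {t<..<y} f"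
      by (rule set_integrable_subset[OF int[of t y]]) auto
    have int'': "set_integrable ?M {t} f"
      by (rule set_integrable_subset[OF int[of t y]]) (use \<open>t < y\<close> in auto)
    have "F y - F t = f t * (rlim g t - g t) + set_lebesgue_integral ?M {t<..<y} f"
      using diff[of t y] \<open>t < y\<close> set_integral_Un[OF _ int'' int'] unfolding un
      by (simp add: integral_singleton)
    then have "F y - rlim F t = set_lebesgue_integral ?M {t<..<y} f"
      by (simp add: g_antiderivative_rlim[OF F])
    moreover have "emeasure ?M {t<..<y} = ennreal (g y - rlim g t)"
    proof -
      have "ennreal (g y - g t) = emeasure ?M {t} + emeasure ?M {t<..<y}"
        using emeasure_LS_measure[OF derivator, of t y] \<open>t < y\<close> unfolding un
        by (subst plus_emeasure) auto
      also have "emeasure ?M {t} = ennreal (rlim g t - g t)"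
        by (rule emeasure_LS_measure_singleton[OF derivator])
      also have "ennreal (g y - g t) = ennreal (rlim g t - g t) + ennreal (g y - rlim g t)"
        using rlim_bounds[OF mono_g] \<open>t < y\<close> by (subst ennreal_plus[symmetric]) auto
      finally show ?thesis by simp
    qed
    ultimately show ?thesis
      by (intro that[of "{t<..<y}"]) (use RightPt int' rlim_bounds(2)[OF mono_g] in auto)
  qed
qed

text \<open>A jump leaves a hole in the values of \<open>g\<close>: an extended point above
  \<open>g t\<close> is a real beyond \<open>t\<close> or a right point at or beyond
  \<open>t\<close>.\<close>

lemma ext_g_gap:
  assumes "b \<in> ext_line g" "g t < ext_eval g b"
  shows "rlim g t \<le> ext_eval g b"
proof (cases b)
  case (Pt s)
  then show ?thesis using assms rlim_bounds(2)[OF mono_g] g_less_imp_less by simp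
next
  case (RightPt s)
  then have "t \<le> s" using assms rlim_bounds(2)[OF mono_g, of s t] by fastforce
  then show ?thesis using rlim_mono[OF mono_g] RightPt by simp
qed

lemma ext_g_le_left:
  assumes "a \<in> ext_line g" "ext_eval g a < rlim g s"
  shows "ext_eval g a \<le> g s"
proof (rule ccontr)
  assume "\<not> ?thesis"
  then show False using ext_g_gap[OF assms(1), of s] assms(2) by simp
qed

text \<open>If one point is real, the increment is an integral over a null set. Two right points
  with equal \<open>g\<close>-values coincide, because jumps at different points do not
  overlap.\<close>

lemma ext_eval_cong:
  assumes F: "g_antiderivative g F f" and a: "a \<in> ext_line g" and b: "b \<in> ext_line g"
    and eq: "ext_eval g a = ext_eval g b"
  shows "ext_eval F a = ext_eval F b"
proof -
  have *: "ext_eval F c = F y" if c: "c \<in> ext_line g" "ext_eval g c = g y" for c y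
  proof -
    obtain J where J: "J \<in> sets borel" "emeasure (LS_measure g) J = ennreal (g y - ext_eval g c)"
      "F y - ext_eval F c = set_lebesgue_integral (LS_measure g) J f"
      using g_antiderivative_ext_integral[OF F c(1), of y] c(2) by auto
    then have "J \<in> null_sets (LS_measure g)" using c(2) by (auto simp: null_sets_def)
    then show ?thesis using J(3) by (simp add: set_integral_null)
  qed
  show ?thesis
  proof (cases b)
    case (Pt y) then show ?thesis using *[OF a, of y] eq by simp
  next
    case b': (RightPt s)
    show ?thesis
    proof (cases a)
      case (Pt x) then show ?thesis using *[OF b, of x] eq by simp
    next
      case (RightPt t)
      have "g t < rlim g t" "g s < rlim g s" using a b RightPt b' by (auto simp: ext_line_def jumps_def)
      then have "s = t"
        using rlim_bounds(2)[OF mono_g, of s t] rlim_bounds(2)[OF mono_g, of t s] eq RightPt b'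
        by (cases s t rule: linorder_cases) auto
      then show ?thesis using b' RightPt by simp
    qed
  qed
qed

text \<open>A density that is positive almost everywhere on a set of positive mass has a positive
  integral.\<close>

lemma ext_eval_strict_mono:
  assumes F: "g_antiderivative g F f" and a: "a \<in> ext_line g" and b: "b \<in> ext_line g"
    and less: "ext_eval g a < ext_eval g b"
    and pos: "\<And>r. ext_eval g a \<le> g r \<Longrightarrow> g r < ext_eval g b \<Longrightarrow> f r > 0"
  shows "ext_eval F a < ext_eval F b"
proof -
  have *: "ext_eval F a < F y"
    if y: "ext_eval g a < g y" "g y \<le> ext_eval g b" for y
  proof -
    let ?M = "LS_measure g"
    obtain J where J: "J \<in> sets borel" "J \<subseteq> {r. ext_eval g a \<le> g r \<and> r < y}"
      "emeasure ?M J = ennreal (g y - ext_eval g a)" "set_integrable ?M J f"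
      "F y - ext_eval F a = set_lebesgue_integral ?M J f"
      using g_antiderivative_ext_integral[OF F a, of y] y by (metis less_imp_le)
    \<comment> \<open>\<open>J\<close> is bounded by \<open>r < y\<close>, whereas
      \<open>pos\<close> needs \<open>g r < ext_eval g b\<close>; the plateau on which the two
      conditions may differ is null.\<close>
    have AE: "AE r in ?M. r \<in> J \<longrightarrow> f r > 0"
      using AE_g_less[of y] by eventually_elim (use J(2) pos y in force)
    then have nonneg: "AE r in ?M. 0 \<le> indicat_real J r *\<^sub>R f r"
      by eventually_elim (auto simp: indicator_def)
    then have "0 \<le> F y - ext_eval F a"
      unfolding J(5) set_lebesgue_integral_def by (rule integral_nonneg_AE)
    moreover have "F y - ext_eval F a \<noteq> 0"
    proof
      assume "F y - ext_eval F a = 0"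
      then have "AE r in ?M. indicat_real J r *\<^sub>R f r = 0"
        using integral_nonneg_eq_0_iff_AE[OF J(4)[unfolded set_integrable_def] nonneg] J(5)
        by (simp add: set_lebesgue_integral_def)
      with AE have "AE r in ?M. r \<notin> J"
        by eventually_elim (auto simp: indicator_def)
      then have "emeasure ?M J = 0"
        using J(1) by (subst (asm) AE_iff_null_sets[symmetric]) (auto simp: null_sets_def)
      then show False using J(3) y by simp
    qed
    ultimately show ?thesis by simp
  qed
  show ?thesis
  proof (cases b)
    case (Pt y) then show ?thesis using *[of y] less by simp
  next
    case (RightPt s)
    \<comment> \<open>The path goes to \<open>s\<close> first, perhaps without any gain in
      \<open>g\<close>, hence with a weak inequality; the jump at \<open>s\<close> then adds a
      positive amount.\<close>
    then have s: "rlim g s - g s > 0" using b by (auto simp: ext_line_def jumps_def)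
    have le: "ext_eval g a \<le> g s" using ext_g_le_left[OF a] less RightPt by simp
    have "ext_eval F a \<le> F s"
    proof (cases "ext_eval g a = g s")
      case True
      then show ?thesis using ext_eval_cong[OF F a, of "Pt s"] by (simp add: ext_line_def)
    next
      case False
      then show ?thesis using *[of s] le s RightPt by simp
    qed
    moreover have "f s > 0" using pos[of s] le s RightPt by simp
    then have "f s * (rlim g s - g s) > 0" using s by simp
    ultimately show ?thesis
      using RightPt by (simp add: g_antiderivative_rlim[OF F])
  qed
qed

section \<open>Intermediate values\<close>

lemma root_values_IVT_aux:
  assumes Q: "g_antiderivative g Q q" and r: "Q r > 0" and s: "Q s < 0" and less: "g r < g s"
  shows "\<exists>c\<in>root_values g Q. g r \<le> c \<and> c < g s"
proof -
  \<comment> \<open>The infimum \<open>u\<close> is where \<open>Q\<close> stops being positive: the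
    root sits at \<open>u\<close> or at its right point.\<close>
  define A where "A = {x. r \<le> x \<and> x \<le> s \<and> Q x \<le> 0}"
  define u where "u = Inf A"
  have "r < s" using g_less_imp_less[OF less] .
  then have sA: "s \<in> A" using s by (auto simp: A_def)
  have bdd: "bdd_below A" by (rule bdd_belowI[of _ r]) (auto simp: A_def)
  have us: "u \<le> s" unfolding u_def using sA bdd by (rule cInf_lower)
  have ru: "r \<le> u" unfolding u_def using sA by (intro cInf_greatest) (auto simp: A_def)
  have pos: "Q z > 0" if "r \<le> z" "z < u" for z
    using that us cInf_lower[OF _ bdd, of z] unfolding u_def[symmetric] by (force simp: A_def)
  have Qu: "Q u \<ge> 0"
  proof (cases "r = u")
    case False
    then have "\<forall>\<^sub>F x in at_left u. 0 \<le> Q x"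
      unfolding eventually_at_left_field using pos ru by (intro exI[of _ r]) (auto intro: less_imp_le)
    then show ?thesis
      by (intro tendsto_lowerbound[OF g_antiderivative_at_left[OF Q]]) auto
  qed (use r in auto)
  \<comment> \<open>\<open>Q\<close> factors through \<open>g\<close>, so a point with the
    \<open>g\<close>-value of \<open>s\<close> would have \<open>Q < 0\<close>. This makes the upper
    bound strict.\<close>
  have gus: "g u \<noteq> g s"
    using ext_eval_cong[OF Q, of "Pt u" "Pt s"] Qu s by (auto simp: ext_line_def)
  then have gu: "g u < g s" using g_le[OF us] by simp
  show ?thesis
  proof (cases "Q u = 0")
    case True
    then have "g u \<in> root_values g Q"
      unfolding root_values_def by (intro image_eqI[of _ _ "Pt u"]) (auto simp: root_I_def ext_line_def)
    then show ?thesis using gu g_le[OF ru] by blast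
  next
    case False
    then have Qu: "Q u > 0" using Qu by simp
    have lim: "(Q \<longlongrightarrow> rlim Q u) (at_right u)"
      using g_antiderivative_at_right[OF Q] by (simp add: g_antiderivative_rlim[OF Q])
    \<comment> \<open>A positive right limit would keep \<open>Q\<close> positive just beyond
      \<open>u\<close>, so \<open>u\<close> would not be the infimum of \<open>A\<close>.\<close>
    have rl: "rlim Q u \<le> 0"
    proof (rule ccontr)
      assume "\<not> ?thesis"
      then have "\<forall>\<^sub>F x in at_right u. 0 < Q x" using order_tendstoD(1)[OF lim] by simp
      then obtain e where e: "e > u" "\<And>x. u < x \<Longrightarrow> x < e \<Longrightarrow> 0 < Q x"
        unfolding eventually_at_right_field by auto
      have "e \<le> x" if "x \<in> A" for x
        using that e(2)[of x] Qu cInf_lower[OF that bdd] unfolding u_def[symmetric]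
        by (cases "x = u") (force simp: A_def)+
      then have "e \<le> u" unfolding u_def using sA by (intro cInf_greatest) auto
      then show False using e(1) by simp
    qed
    \<comment> \<open>\<open>Q\<close> jumps by \<open>q u * (rlim g u - g u)\<close>, so a jump of
      \<open>Q\<close> needs a jump of \<open>g\<close>.\<close>
    then have "rlim g u \<noteq> g u" using Qu by (auto simp: g_antiderivative_rlim[OF Q])
    then have ju: "u \<in> jumps g" using rlim_bounds(1)[OF mono_g, of u] by (simp add: jumps_def)
    show ?thesis
    proof (cases "rlim Q u = 0")
      case True
      have "rlim g u \<noteq> g s"
        using ext_eval_cong[OF Q, of "RightPt u" "Pt s"] ju True s by (auto simp: ext_line_def)
      moreover have "rlim g u \<le> g s"
        using rlim_bounds(2)[OF mono_g] g_less_imp_less[OF gu] by blast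
      moreover have "rlim g u \<in> root_values g Q"
        unfolding root_values_def using True ju
        by (intro image_eqI[of _ _ "RightPt u"]) (auto simp: root_I_def ext_line_def)
      moreover have "g r \<le> rlim g u" using g_le[OF ru] rlim_bounds(1)[OF mono_g, of u] by simp
      ultimately show ?thesis by (intro bexI[of _ "rlim g u"]) auto
    next
      case False
      then have "Q u * rlim Q u < 0" using rl Qu by (simp add: mult_pos_neg)
      then have "g u \<in> root_values g Q"
        unfolding root_values_def using ju
        by (intro image_eqI[of _ _ "Pt u"]) (auto simp: root_II_def)
      then show ?thesis using gu g_le[OF ru] by blast
    qed
  qed
qed

lemma root_values_IVT:
  assumes Q: "g_antiderivative g Q q" and "Q r * Q s < 0" and less: "g r < g s"
  shows "\<exists>c\<in>root_values g Q. g r \<le> c \<and> c < g s"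
proof (cases "Q r > 0")
  case True
  then show ?thesis
    using assms root_values_IVT_aux[OF Q] by (simp add: mult_less_0_iff)
next
  case False
  then have "- Q r > 0" "- Q s < 0" using assms(2) by (auto simp: mult_less_0_iff)
  then show ?thesis
    using root_values_IVT_aux[OF g_antiderivative_uminus[OF Q] _ _ less] root_values_uminus[OF Q] by simp
qed

section \<open>Rolle's theorem for root values\<close>

lemma ext_line_dense:
  assumes "a \<in> ext_line g" "ext_eval g a < ext_eval g b" "b \<in> ext_line g"
  obtains r where "ext_eval g a \<le> g r" "g r < ext_eval g b"
proof (cases a)
  case (Pt x) then show ?thesis using that[of x] assms by simp
next
  case (RightPt t)
  then have "\<forall>\<^sub>F r in at_right t. g r < ext_eval g b"
    using assms order_tendstoD(2)[OF rlim_tendsto[OF mono_g]] by simp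
  then obtain e where e: "e > t" "\<And>r. t < r \<Longrightarrow> r < e \<Longrightarrow> g r < ext_eval g b"
    unfolding eventually_at_right_field by auto
  obtain r where "t < r" "r < e" using dense[OF e(1)] by auto
  then show ?thesis using that[of r] e(2) rlim_bounds(2)[OF mono_g] RightPt by simp
qed

text \<open>With \<open>Q\<close> positive, \<open>P\<close> climbs from the root \<open>a\<close>
  and is positive at \<open>b\<close>. Hence \<open>b\<close> is of type II with a downward jump,
  where \<open>Q\<close> is negative, and this sign change yields a root of
  \<open>Q\<close>.\<close>

lemma root_values_Rolle_aux:
  assumes P: "g_antiderivative g P Q" and Q: "g_antiderivative g Q q"
    and a: "root_I g P a \<or> root_II g P a" and b: "root_I g P b \<or> root_II g P b"
    and less: "ext_eval g a < ext_eval g b"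
    and pos: "\<And>r. ext_eval g a \<le> g r \<Longrightarrow> g r < ext_eval g b \<Longrightarrow> Q r > 0"
  shows "\<exists>c\<in>root_values g Q. ext_eval g a \<le> c \<and> c < ext_eval g b"
proof -
  have al: "a \<in> ext_line g" and bl: "b \<in> ext_line g"
    using a b by (auto simp: root_I_def root_II_def ext_line_def)
  have Pb: "ext_eval P b > 0"
    using a
  proof
    assume "root_I g P a"
    then show ?thesis
      using ext_eval_strict_mono[OF P al bl less pos] by (simp add: root_I_def)
  next
    assume "root_II g P a"
    then obtain t where t: "t \<in> jumps g" "a = Pt t" "P t * rlim P t < 0"
      by (auto simp: root_II_def)
    \<comment> \<open>The type II root at \<open>t\<close> is crossed upwards, so the climb restarts
      at the right point with \<open>P\<close> already positive. That point may share its
      \<open>g\<close>-value with \<open>b\<close>; factorisation through \<open>g\<close> then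
      suffices.\<close>
    have "Q t > 0" using pos[of t] less t by simp
    then have "P t < rlim P t" using t(1) by (simp add: g_antiderivative_rlim[OF P] jumps_def)
    then have Pt: "rlim P t > 0" using t(3) by (auto simp: mult_less_0_iff)
    have tl: "RightPt t \<in> ext_line g" using t(1) by (simp add: ext_line_def)
    have gt: "rlim g t \<le> ext_eval g b" using ext_g_gap[OF bl] less t(2) by simp
    have ga: "ext_eval g a \<le> rlim g t" using t(2) rlim_bounds(1)[OF mono_g] by simp
    show ?thesis
    proof (cases "rlim g t = ext_eval g b")
      case True
      then show ?thesis using ext_eval_cong[OF P tl bl] Pt by simp
    next
      case False
      then have "rlim P t < ext_eval P b"
        using ext_eval_strict_mono[OF P tl bl] gt ga pos by simp
      then show ?thesis using Pt by simp
    qed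
  qed
  then obtain s where s: "s \<in> jumps g" "b = Pt s" "P s * rlim P s < 0"
    using b by (auto simp: root_I_def root_II_def)
  have "rlim P s < P s" using s Pb by (auto simp: mult_less_0_iff)
  then have Qs: "Q s < 0"
    using s(1) by (auto simp: g_antiderivative_rlim[OF P] jumps_def mult_less_0_iff)
  obtain r where r: "ext_eval g a \<le> g r" "g r < ext_eval g b"
    using ext_line_dense[OF al less bl] .
  have "Q r * Q s < 0" using r pos[of r] Qs by (simp add: mult_pos_neg)
  moreover have "g r < g s" using r(2) s(2) by simp
  ultimately obtain c where "c \<in> root_values g Q" "g r \<le> c" "c < g s"
    using root_values_IVT[OF Q] by blast
  then show ?thesis using r(1) s(2) by (intro bexI[of _ c]) auto
qed

text \<open>Without a root in the range, the intermediate value property keeps the sign of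
  \<open>Q\<close> constant there; negating \<open>P\<close> if necessary makes \<open>Q\<close>
  positive, and the previous lemma gives a contradiction.\<close>

lemma root_values_Rolle:
  assumes P: "g_antiderivative g P Q" and Q: "g_antiderivative g Q q"
    and v: "v \<in> root_values g P" and w: "w \<in> root_values g P" and "v < w"
  shows "\<exists>c\<in>root_values g Q. v \<le> c \<and> c < w"
proof (rule ccontr)
  assume no: "\<not> ?thesis"
  have sign: "Q r * Q s > 0" if rs: "v \<le> g r" "g r < w" "v \<le> g s" "g s < w" for r s
  proof (rule ccontr)
    assume n: "\<not> ?thesis"
    have nz: "Q z \<noteq> 0" if "v \<le> g z" "g z < w" for z
    proof
      assume "Q z = 0"
      then have "g z \<in> root_values g Q"
        unfolding root_values_def by (intro image_eqI[of _ _ "Pt z"]) (auto simp: root_I_def ext_line_def)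
      then show False using no that by blast
    qed
    have m: "Q r * Q s < 0" using n nz[of r] nz[of s] rs by (simp add: not_less order.strict_iff_order)
    have "g r \<noteq> g s"
      using ext_eval_cong[OF Q, of "Pt r" "Pt s"] m by (auto simp: ext_line_def not_less)
    then consider "g r < g s" | "g s < g r" by linarith
    then show False
    proof cases
      case 1 then show ?thesis using root_values_IVT[OF Q m] no rs by force
    next
      case 2 then show ?thesis using root_values_IVT[OF Q, of s r] m no rs by (force simp: mult.commute)
    qed
  qed
  have Pm: "g_antiderivative g (\<lambda>x. - P x) (\<lambda>x. - Q x)"
    and Qm: "g_antiderivative g (\<lambda>x. - Q x) (\<lambda>x. - q x)"
    by (intro g_antiderivative_uminus P Q)+
  have "\<exists>r. v \<le> g r \<and> g r < w"
  proof -
    obtain a b where "a \<in> ext_line g" "v = ext_eval g a" "b \<in> ext_line g" "w = ext_eval g b"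
      using v w by (auto simp: root_values_def root_I_def root_II_def ext_line_def)
    then show ?thesis using ext_line_dense[of a b] \<open>v < w\<close> by metis
  qed
  then obtain r where r: "v \<le> g r" "g r < w" by blast
  show False
  proof (cases "Q r > 0")
    case True
    then have pos: "Q s > 0" if "v \<le> g s" "g s < w" for s
      using sign[OF r that] by (simp add: zero_less_mult_iff)
    obtain a b where "root_I g P a \<or> root_II g P a" "v = ext_eval g a"
      "root_I g P b \<or> root_II g P b" "w = ext_eval g b"
      using v w by (auto simp: root_values_def)
    then show False using root_values_Rolle_aux[OF P Q, of a b] pos \<open>v < w\<close> no by blast
  next
    case False
    then have pos: "- Q s > 0" if "v \<le> g s" "g s < w" for s
      using sign[OF r that] by (auto simp: zero_less_mult_iff)
    have "v \<in> root_values g (\<lambda>x. - P x)" "w \<in> root_values g (\<lambda>x. - P x)"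
      using v w root_values_uminus[OF P] by auto
    then obtain a b where "root_I g (\<lambda>x. - P x) a \<or> root_II g (\<lambda>x. - P x) a" "v = ext_eval g a"
      "root_I g (\<lambda>x. - P x) b \<or> root_II g (\<lambda>x. - P x) b" "w = ext_eval g b"
      by (auto simp: root_values_def)
    then show False
      using root_values_Rolle_aux[OF Pm Qm, of a b] pos \<open>v < w\<close> no root_values_uminus[OF Q] by blast
  qed
qed

section \<open>Differentiation of g-polynomials and induction on the degree\<close>

lemma locally_g_integrable_gmonomial: "locally_g_integrable g (gmonomial g x0 k)"
proof (induction k)
  case 0
  then show ?case by (auto intro!: mono_locally_g_integrable monoI)
next
  case (Suc k)
  show ?case
    unfolding gmonomial.simps
    by (rule g_antiderivative_locally_g_integrable
        [OF g_antiderivative_cmult[OF g_antiderivative_gintegral[OF Suc]]])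
qed

lemma gpolynomial_Suc:
  "gpolynomial g x0 (Suc n) lam x =
     lam 0 + (\<Sum>k\<le>n. lam (Suc k) * gmonomial g x0 (Suc k) x)"
  unfolding gpolynomial_def by (subst sum.atMost_Suc_shift) simp

text \<open>Termwise differentiation by the recursion of the monomials: the constant term drops out
  and the index shifts.\<close>

lemma g_antiderivative_gpolynomial_Suc:
  "g_antiderivative g (gpolynomial g x0 (Suc n) lam)
     (gpolynomial g x0 n (\<lambda>k. real (Suc k) * lam (Suc k)))"
proof -
  have "g_antiderivative g (gmonomial g x0 (Suc k)) (\<lambda>x. real (Suc k) * gmonomial g x0 k x)" for k
    unfolding gmonomial.simps
    by (intro g_antiderivative_cmult g_antiderivative_gintegral locally_g_integrable_gmonomial)
  then have "g_antiderivative g (\<lambda>x. lam 0 + (\<Sum>k\<le>n. lam (Suc k) * gmonomial g x0 (Suc k) x))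
      (\<lambda>x. 0 + (\<Sum>k\<le>n. lam (Suc k) * (real (Suc k) * gmonomial g x0 k x)))"
    by (intro g_antiderivative_add g_antiderivative_const g_antiderivative_sum g_antiderivative_cmult) auto
  then show ?thesis
    unfolding gpolynomial_Suc[abs_def] unfolding gpolynomial_def[abs_def]
    by (simp add: mult_ac del: gmonomial.simps)
qed

text \<open>In the Rolle step the derived polynomial must itself be an antiderivative, including in
  degree 0, where its density is 0.\<close>

lemma gpolynomial_has_g_derivative:
  "\<exists>q. g_antiderivative g (gpolynomial g x0 n lam) q"
proof (cases n)
  case 0
  then show ?thesis
    using g_antiderivative_const[of g "lam 0"] by (auto simp: gpolynomial_def[abs_def])
next
  case (Suc m)
  then show ?thesis using g_antiderivative_gpolynomial_Suc by blast
qed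

lemma root_values_const:
  assumes "c \<noteq> 0" shows "root_values g (\<lambda>x. c) = {}"
proof -
  have "rlim (\<lambda>x. c) t = c" for t
    using g_antiderivative_rlim[OF g_antiderivative_const] by simp
  then have e: "ext_eval (\<lambda>x. c) x = c" for x by (cases x) simp_all
  have "\<not> c * c < 0" by (simp add: not_less)
  then show ?thesis
    using assms by (simp add: root_values_def root_I_def root_II_def e)
qed

text \<open>Each use of Rolle loses one root value while the degree drops by one, so the count stays
  one ahead of the degree.\<close>

lemma gpolynomial_coeffs_zero:
  assumes "finite V" "card V = Suc n" "V \<subseteq> root_values g (gpolynomial g x0 n lam)"
  shows "\<forall>k\<le>n. lam k = 0"
  using assms
proof (induction n arbitrary: V lam)
  case 0
  have "gpolynomial g x0 0 lam = (\<lambda>x. lam 0)" by (simp add: gpolynomial_def fun_eq_iff)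
  with 0 have "root_values g (\<lambda>x. lam 0) \<noteq> {}" by auto
  then show ?case using root_values_const[of "lam 0"] by auto
next
  case (Suc n)
  let ?mu = "\<lambda>k. real (Suc k) * lam (Suc k)"
  let ?Q = "gpolynomial g x0 n ?mu"
  obtain q where q: "g_antiderivative g ?Q q" using gpolynomial_has_g_derivative by blast
  have "\<exists>c\<in>root_values g ?Q. a \<le> c \<and> c < b" if "a \<in> V" "b \<in> V" "a < b" for a b
    by (rule root_values_Rolle[OF g_antiderivative_gpolynomial_Suc q
          subsetD[OF Suc.prems(3) that(1)] subsetD[OF Suc.prems(3) that(2)] that(3)])
  then obtain V' where V': "V' \<subseteq> root_values g ?Q" "finite V'" "card V' = Suc n"
    using separated_values_card[OF Suc.prems(1,2)] by blast
  have "\<forall>k\<le>n. ?mu k = 0" by (rule Suc.IH[OF V'(2,3,1)])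
  \<comment> \<open>The factor \<open>real (Suc k)\<close> is nonzero, so only the constant term is
    left; having a root, it must vanish.\<close>
  then have mu: "lam (Suc k) = 0" if "k \<le> n" for k using that by simp
  then have "gpolynomial g x0 (Suc n) lam = (\<lambda>x. lam 0)"
    by (intro ext) (simp add: gpolynomial_Suc del: gmonomial.simps)
  with Suc.prems have "root_values g (\<lambda>x. lam 0) \<noteq> {}" by auto
  then have "lam 0 = 0" using root_values_const[of "lam 0"] by blast
  show ?case
  proof (intro allI impI)
    fix k assume "k \<le> Suc n"
    then show "lam k = 0" using \<open>lam 0 = 0\<close> mu by (cases k) simp_all
  qed
qed

end

theorem theorem4p6:
  fixes g :: "real \<Rightarrow> real" and n :: nat and x0 :: real
    and lam :: "nat \<Rightarrow> real" and S :: "ext_point set"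
  assumes "derivator g"
    and "S \<subseteq> ext_line g"
    and "card S = n + 1"
    and "pairwise (g_distinct g) S"
    and "\<forall>x\<in>S. root_I g (gpolynomial g x0 n lam) x \<or> root_II g (gpolynomial g x0 n lam) x"
  shows "\<forall>k\<le>n. lam k = 0"
proof -
  have "inj_on (ext_eval g) S"
    using assms(4) by (force simp: inj_on_def pairwise_def g_distinct_def)
  then have "card (ext_eval g ` S) = Suc n" using assms(3) by (simp add: card_image)
  \<comment> \<open>Infinite sets have cardinality 0 by convention, so a successor cardinality
    yields finiteness.\<close>
  moreover from this have "finite (ext_eval g ` S)" by (intro card_ge_0_finite) simp
  moreover have "ext_eval g ` S \<subseteq> root_values g (gpolynomial g x0 n lam)"
    using assms(5) by (auto simp: root_values_def)
  ultimately show ?thesis using gpolynomial_coeffs_zero[OF assms(1)] by blast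
qed

end
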